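(* (Brodén–Borel–Lévy formula) Let $N\ge1$ be an integer and let $\lambda$ be Lebesgue measure on $I=[0,1]$. For any $n\in\mathbb{N}_+$, the conditional probability of the event $\{T_N^n<x\}$ given the digits $a_1,\dots,a_n$ is $$\lambda(T_N^n<x\mid a_1,\dots,a_n)=\frac{(s_n+N)x}{s_nx+N},\qquad x\in I.$$ (That is, for all integers $i_1,\dots,i_n\ge N$, the formula holds for conditioning on the event $a_1=i_1,\dots,a_n=i_n$, with $s_n$ the value determined by $i_1,\dots,i_n$.)
   Context: $\mathbb{N}_+=\{1,2,3,\dots\}$. $T_N:I\to I$ is defined by $T_N(x)=N/x-\lfloor N/x\rfloor$ for $x\ne0$ and $T_N(0)=0$. For $x\in I\setminus\mathbb{Q}$ the digits are $a_n=a_n(x)=\lfloor N/T_N^{n-1}(x)\rfloor$, $n\ge1$; they satisfy $a_n\ge N$. Define $q_{-1}=0$, $q_0=1$, $q_n=a_nq_{n-1}+Nq_{n-2}$ for $n\ge1$, and $s_0:=0$, $s_n:=N\,q_{n-1}/q_n$ for $n\ge1$; equivalently $s_n=N/(a_n+s_{n-1})$ for $n\ge1$. For a probability measure $\mu$ and $\mu(B)>0$, $\mu(A\mid B)=\mu(A\cap B)/\mu(B)$. *)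

theory Defs
  imports "HOL-Probability.Probability"
begin

definition gauss_map :: "nat \<Rightarrow> real \<Rightarrow> real" where
  "gauss_map N x = (if x = 0 then 0 else real N / x - of_int \<lfloor>real N / x\<rfloor>)"

text \<open>The digit \<open>a\<^sub>n(x)\<close>, meant for \<open>n \<ge> 1\<close> and irrational \<open>x\<close> in \<open>[0,1]\<close>.\<close>
definition digit :: "nat \<Rightarrow> nat \<Rightarrow> real \<Rightarrow> int" where
  "digit N n x = \<lfloor>real N / (gauss_map N ^^ (n - 1)) x\<rfloor>"

text \<open>In the next two functions the digit sequence \<open>a\<close> is indexed from \<open>1\<close>; \<open>a 0\<close> is never used.
  The second equation is \<open>q\<^sub>1 = a\<^sub>1 q\<^sub>0 + N q\<^bsub>-1\<^esub>\<close> with \<open>q\<^sub>0 = 1\<close> and \<open>q\<^bsub>-1\<^esub> = 0\<close>.\<close>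
fun denom_q :: "nat \<Rightarrow> (nat \<Rightarrow> int) \<Rightarrow> nat \<Rightarrow> int" where
  "denom_q N a 0 = 1"
| "denom_q N a (Suc 0) = a 1 * 1 + int N * 0"
| "denom_q N a (Suc (Suc n)) = a (Suc (Suc n)) * denom_q N a (Suc n) + int N * denom_q N a n"

definition s_val :: "nat \<Rightarrow> (nat \<Rightarrow> int) \<Rightarrow> nat \<Rightarrow> real" where
  "s_val N a n =
     (if n = 0 then 0
      else real N * of_int (denom_q N a (n - 1)) / of_int (denom_q N a n))"

end

theory Submission
  imports Defs
begin

text \<open>
  Writing \<open>\<omega> = N / (a\<^sub>1 + N / (a\<^sub>2 + \<dots> + N / (a\<^sub>n + t)))\<close> with \<open>t = T\<^sub>N\<^sup>n(\<omega>)\<close>, the cylinder with digits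
  \<open>a\<^sub>1, \<dots>, a\<^sub>n\<close> is parametrised by \<open>t\<close> through the Moebius map
  \<open>(p\<^sub>n + p\<^bsub>n-1\<^esub> t) / (q\<^sub>n + q\<^bsub>n-1\<^esub> t)\<close> of determinant \<open>\<plusminus>N\<^sup>n\<close>. Up to a countable set, the event
  \<open>T\<^sub>N\<^sup>n < x\<close> inside the cylinder is the image of \<open>[0,x]\<close>, an interval of length
  \<open>N\<^sup>n x / (q\<^sub>n (q\<^sub>n + q\<^bsub>n-1\<^esub> x))\<close>. Dividing by the value at \<open>x = 1\<close> gives the formula.
\<close>

fun cf_value :: "nat \<Rightarrow> (nat \<Rightarrow> int) \<Rightarrow> nat \<Rightarrow> real \<Rightarrow> real" where
  "cf_value N a 0 t = t"
| "cf_value N a (Suc n) t = cf_value N a n (real N / (of_int (a (Suc n)) + t))"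

lemma gauss_map_bounds: "0 \<le> gauss_map N x" "gauss_map N x < 1"
  unfolding gauss_map_def by (auto, linarith)

text \<open>\<open>cf_value\<close> inserts the newest digit innermost, just as
  \<open>gauss_map ^^ Suc n\<close> applies one more \<open>gauss_map\<close> outermost. So each
  step only has to undo one \<open>gauss_map\<close> by solving
  \<open>N / u = a + gauss_map N u\<close> for \<open>u\<close>. This places every point of the
  cylinder in the image of \<open>cf_value\<close>.\<close>

lemma cf_value_gauss_map_iterate:
  assumes "\<forall>k\<in>{1..n}. digit N k \<omega> = a k" and "\<forall>k\<in>{1..n}. a k \<ge> 1"
  shows "cf_value N a n ((gauss_map N ^^ n) \<omega>) = \<omega>"
  using assms
proof (induction n)
  case 0
  then show ?case by simp
next
  case (Suc n)
  define u where "u = (gauss_map N ^^ n) \<omega>"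
  have fl: "\<lfloor>real N / u\<rfloor> = a (Suc n)"
    using Suc.prems(1) by (auto simp: digit_def u_def dest!: bspec[of _ _ "Suc n"])
  moreover have "a (Suc n) \<ge> 1"
    using Suc.prems(2) by auto
  \<comment> \<open>Since \<open>N / 0 = 0\<close> in HOL, \<open>u = 0\<close> or
    \<open>N = 0\<close> would give the digit 0.\<close>
  ultimately have "u \<noteq> 0 \<and> N \<noteq> 0"
    by (cases "u = 0"; cases "N = 0") auto
  then have "real N / (of_int (a (Suc n)) + gauss_map N u) = u"
    using fl by (simp add: gauss_map_def)
  then show ?case
    using Suc.IH Suc.prems by (simp add: u_def)
qed

text \<open>The converse direction: every admissible digit string is realised. The open interval
  matters: \<open>t < 1\<close> makes the floor of \<open>a + t\<close> equal to \<open>a\<close>,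
  and \<open>t > 0\<close> keeps \<open>N / (a + t)\<close> below 1 even when \<open>a = N\<close>,
  so the induction stays inside the interval.\<close>

lemma gauss_map_iterate_cf_value:
  assumes "N \<ge> 1" and "\<forall>k\<in>{1..n}. a k \<ge> int N" and "0 < t" "t < 1"
  shows "cf_value N a n t \<in> {0<..<1} \<and> (gauss_map N ^^ n) (cf_value N a n t) = t
    \<and> (\<forall>k\<in>{1..n}. digit N k (cf_value N a n t) = a k)"
  using assms(2-)
proof (induction n arbitrary: t)
  case 0
  then show ?case by simp
next
  case (Suc n)
  define u where "u = real N / (of_int (a (Suc n)) + t)"
  have a: "a (Suc n) \<ge> int N"
    using Suc.prems by auto
  then have a': "real_of_int (a (Suc n)) \<ge> real N"
    by linarith
  have u: "0 < u" "u < 1"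
    using assms(1) a' Suc.prems by (auto simp: u_def field_simps)
  have Nu: "real N / u = of_int (a (Suc n)) + t"
    using assms(1) a' Suc.prems by (simp add: u_def)
  then have fl: "\<lfloor>real N / u\<rfloor> = a (Suc n)"
    using Suc.prems by (simp add: floor_eq_iff)
  have IH: "cf_value N a n u \<in> {0<..<1}" "(gauss_map N ^^ n) (cf_value N a n u) = u"
    "\<forall>k\<in>{1..n}. digit N k (cf_value N a n u) = a k"
    using Suc.IH[of u] Suc.prems u by auto
  have "gauss_map N u = t"
    using Nu fl u by (simp add: gauss_map_def)
  moreover have "digit N (Suc n) (cf_value N a n u) = a (Suc n)"
    using IH(2) fl by (simp add: digit_def)
  ultimately show ?case
    using IH by (simp add: atLeastAtMostSuc_conv flip: u_def)
qed

lemma denom_q_pos: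
  assumes "\<forall>k\<in>{1..n}. a k \<ge> 1"
  shows "denom_q N a n > 0"
  using assms
proof (induction N a n rule: denom_q.induct)
  case (3 N a n)
  then have "denom_q N a (Suc n) > 0" "denom_q N a n > 0" "a (Suc (Suc n)) \<ge> 1"
    by auto
  then show ?case
    by (simp add: add_pos_nonneg)
qed auto

text \<open>Substituting \<open>N / (b + t)\<close> for \<open>t\<close> multiplies the coefficient
  matrix by one of determinant \<open>-N\<close>, and the denominators follow the recurrence of
  \<open>denom_q\<close>. The numerators stay existential because lengths depend only on the
  absolute determinant.\<close>

lemma cf_value_moebius:
  assumes "\<forall>k\<in>{1..Suc m}. a k \<ge> 1"
  shows "\<exists>p p'. \<bar>p' * of_int (denom_q N a (Suc m)) - p * of_int (denom_q N a m)\<bar> = real N ^ Suc m \<and>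
    (\<forall>t\<ge>0. cf_value N a (Suc m) t =
       (p + p' * t) / (of_int (denom_q N a (Suc m)) + of_int (denom_q N a m) * t))"
  using assms
proof (induction m)
  case 0
  \<comment> \<open>The map is \<open>N / (a 1 + t)\<close>, so \<open>p = N\<close> and
    \<open>p' = 0\<close>.\<close>
  show ?case
    by (rule exI[of _ "real N"], rule exI[of _ 0]) simp
next
  case (Suc m)
  define q q' where "q = real_of_int (denom_q N a (Suc m))" and "q' = real_of_int (denom_q N a m)"
  define b where "b = real_of_int (a (Suc (Suc m)))"
  obtain p p' where det: "\<bar>p' * q - p * q'\<bar> = real N ^ Suc m"
    and val: "\<And>t. t \<ge> 0 \<Longrightarrow> cf_value N a (Suc m) t = (p + p' * t) / (q + q' * t)"
    using Suc by (auto simp: q_def q'_def)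
  have b: "b \<ge> 1"
    using Suc.prems by (simp add: b_def)
  have q: "q > 0" "q' > 0"
    using Suc.prems by (auto simp: q_def q'_def intro!: denom_q_pos)
  have val': "cf_value N a (Suc (Suc m)) t
      = (b * p + real N * p' + p * t) / (b * q + real N * q' + q * t)" if "t \<ge> 0" for t
  proof -
    have bt: "b + t > 0"
      using b that by simp
    have "cf_value N a (Suc (Suc m)) t = cf_value N a (Suc m) (real N / (b + t))"
      by (simp add: b_def)
    also have "\<dots> = (p + p' * (real N / (b + t))) / (q + q' * (real N / (b + t)))"
      using bt by (intro val) simp
    also have "\<dots> = ((p + p' * (real N / (b + t))) * (b + t)) / ((q + q' * (real N / (b + t))) * (b + t))"
      using bt by simp
    also have "\<dots> = (b * p + real N * p' + p * t) / (b * q + real N * q' + q * t)"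
      using bt by (intro arg_cong2[of _ _ _ _ "(/)"]) (simp_all add: distrib_right, simp_all add: algebra_simps)
    finally show ?thesis .
  qed
  have "p * (b * q + real N * q') - (b * p + real N * p') * q = - real N * (p' * q - p * q')"
    by (simp add: algebra_simps)
  then have "\<bar>p * (b * q + real N * q') - (b * p + real N * p') * q\<bar> = real N ^ Suc (Suc m)"
    by (simp add: abs_mult det)
  \<comment> \<open>The old \<open>p\<close> becomes the new coefficient of \<open>t\<close>,
    matching the shift from \<open>q\<close> to the previous denominator.\<close>
  then show ?case
    using val' by (intro exI[of _ "b * p + real N * p'"] exI[of _ p]) (simp add: q_def q'_def b_def)
qed

lemma image_linear_fractional:
  fixes q q' x :: real
  assumes "q > 0" "q' \<ge> 0" "x \<ge> 0"
  shows "(\<lambda>t. t / (q * (q + q' * t))) ` {0..x} = {0..x / (q * (q + q' * x))}"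
proof -
  let ?g = "\<lambda>t. t / (q * (q + q' * t))"
  have pos: "q + q' * t > 0" if "t \<ge> 0" for t
    using assms that by (simp add: add_pos_nonneg)
  have mono: "?g s \<le> ?g t" if "0 \<le> s" "s \<le> t" for s t
  proof -
    have "s / (q + q' * s) \<le> t / (q + q' * t)"
      \<comment> \<open>After cross-multiplication the terms in \<open>s * t\<close> cancel and
        \<open>q * (s - t)\<close> remains.\<close>
      using that pos[of s] pos[of t] assms by (simp add: frac_le_eq divide_le_0_iff algebra_simps)
    then have "s / (q + q' * s) / q \<le> t / (q + q' * t) / q"
      using assms(1) by (intro divide_right_mono) auto
    then show ?thesis
      by (simp add: mult.commute[of q])
  qed
  have "continuous_on {0..x} ?g"
    using assms pos by (intro continuous_intros) (auto simp: less_le)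
  then have "\<exists>t\<ge>0. t \<le> x \<and> ?g t = y" if "0 \<le> y" "y \<le> ?g x" for y
    using IVT'[of ?g 0 y x] that assms by auto
  then show ?thesis
    using mono mono[of 0] by (fastforce simp: image_iff)
qed

text \<open>Splitting off the value \<open>p / q\<close> at 0 leaves the determinant times the
  increasing map of \<open>image_linear_fractional\<close>. The image is therefore an affine image
  of an interval starting at 0; the sign of the determinant only decides on which side of
  \<open>p / q\<close> it lies.\<close>

lemma measure_image_moebius:
  fixes p p' q q' x :: real
  assumes "q > 0" "q' \<ge> 0" "x \<ge> 0"
  shows "(\<lambda>t. (p + p' * t) / (q + q' * t)) ` {0..x} \<in> lmeasurable"
    and "measure lebesgue ((\<lambda>t. (p + p' * t) / (q + q' * t)) ` {0..x})
      = \<bar>p' * q - p * q'\<bar> * x / (q * (q + q' * x))"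
proof -
  define d where "d = p' * q - p * q'"
  define y where "y = x / (q * (q + q' * x))"
  have pos: "q + q' * t > 0" if "t \<ge> 0" for t
    using assms that by (simp add: add_pos_nonneg)
  have "y \<ge> 0"
    using assms pos[of x] by (simp add: y_def)
  have "(p + p' * t) / (q + q' * t) = d * (t / (q * (q + q' * t))) + p / q" if "t \<ge> 0" for t
    using assms pos[OF that] by (simp add: d_def divide_simps) (simp add: algebra_simps)
  then have "(\<lambda>t. (p + p' * t) / (q + q' * t)) ` {0..x}
      = (\<lambda>u. d * u + p / q) ` (\<lambda>t. t / (q * (q + q' * t))) ` {0..x}"
    unfolding image_image by (intro image_cong) auto
  also have "\<dots> = (\<lambda>u. d * u + p / q) ` {0..y}"
    using assms by (simp add: image_linear_fractional y_def)
  also have "\<dots> = (if 0 \<le> d then {p / q..d * y + p / q} else {d * y + p / q..p / q})"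
    using \<open>y \<ge> 0\<close> by (auto simp: image_affinity_atLeastAtMost)
  finally have im: "(\<lambda>t. (p + p' * t) / (q + q' * t)) ` {0..x}
      = (if 0 \<le> d then {p / q..d * y + p / q} else {d * y + p / q..p / q})" .
  then show "(\<lambda>t. (p + p' * t) / (q + q' * t)) ` {0..x} \<in> lmeasurable"
    by simp
  have "measure lebesgue ((\<lambda>t. (p + p' * t) / (q + q' * t)) ` {0..x}) = \<bar>d\<bar> * y"
    unfolding im using \<open>y \<ge> 0\<close> by (auto simp: mult_nonneg_nonneg mult_nonpos_nonneg)
  then show "measure lebesgue ((\<lambda>t. (p + p' * t) / (q + q' * t)) ` {0..x})
      = \<bar>p' * q - p * q'\<bar> * x / (q * (q + q' * x))"
    by (simp add: d_def y_def)
qed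

text \<open>The set differs from the image of \<open>{0..x}\<close> under \<open>cf_value\<close> by
  a negligible set, so its measure is the length of that interval, and completeness of Lebesgue
  measure spares a separate measurability argument.\<close>

lemma measure_cylinder_gauss_map_less:
  fixes x :: real
  assumes N: "N \<ge> 1" and n: "n \<ge> 1" and a: "\<forall>k\<in>{1..n}. a k \<ge> int N" and x: "x \<in> {0..1}"
  shows "measure (lebesgue_on {0..1}) {\<omega>\<in>{0..1}. (gauss_map N ^^ n) \<omega> < x \<and>
           \<omega> \<notin> \<rat> \<and> (\<forall>k\<in>{1..n}. digit N k \<omega> = a k)}
    = real N ^ n * x / (of_int (denom_q N a n) *
        (of_int (denom_q N a n) + of_int (denom_q N a (n - 1)) * x))"
    (is "measure _ ?S = _")
proof -
  obtain m where m: "n = Suc m"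
    using n by (cases n) auto
  have a1: "\<forall>k\<in>{1..n}. a k \<ge> 1"
    using N a by force
  define q q' where "q = real_of_int (denom_q N a n)" and "q' = real_of_int (denom_q N a (n - 1))"
  have q: "q > 0" "q' \<ge> 0"
    using a1 by (auto simp: q_def q'_def intro!: denom_q_pos less_imp_le[OF denom_q_pos])
  obtain p p' where det: "\<bar>p' * q - p * q'\<bar> = real N ^ n"
    and val: "\<And>t. t \<ge> 0 \<Longrightarrow> cf_value N a n t = (p + p' * t) / (q + q' * t)"
    using cf_value_moebius[of m a N] a1 by (auto simp: m q_def q'_def)
  let ?J = "cf_value N a n ` {0..x}"
  have J: "?J = (\<lambda>t. (p + p' * t) / (q + q' * t)) ` {0..x}"
    by (intro image_cong) (auto simp: val)
  have J_meas: "?J \<in> lmeasurable"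
    and J_measure: "measure lebesgue ?J = real N ^ n * x / (q * (q + q' * x))"
    using measure_image_moebius[of q q' x p p'] q x by (auto simp: J det)
  have "?S \<subseteq> ?J"
  proof
    fix \<omega> assume \<omega>: "\<omega> \<in> ?S"
    then have "\<omega> = cf_value N a n ((gauss_map N ^^ n) \<omega>)"
      using cf_value_gauss_map_iterate[of n N \<omega> a] a1 by simp
    moreover have "(gauss_map N ^^ n) \<omega> \<in> {0..x}"
      using \<omega> gauss_map_bounds by (simp add: m)
    ultimately show "\<omega> \<in> ?J"
      by blast
  qed
  \<comment> \<open>For \<open>t\<close> strictly between 0 and \<open>x\<close>, the digits and the
    iterate come out as required, so only irrationality can fail.\<close>
  moreover have "?J - ?S \<subseteq> cf_value N a n ` {0, x} \<union> \<rat>"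
  proof
    fix \<omega> assume \<omega>: "\<omega> \<in> ?J - ?S"
    then obtain t where t: "\<omega> = cf_value N a n t" "0 \<le> t" "t \<le> x"
      by auto
    show "\<omega> \<in> cf_value N a n ` {0, x} \<union> \<rat>"
    proof (cases "t \<in> {0, x}")
      case False
      then show ?thesis
        using gauss_map_iterate_cf_value[OF N a, of t] t x \<omega> by auto
    qed (use t in blast)
  qed
  then have "countable (?J - ?S)"
    by (rule countable_subset) (simp add: countable_rat)
  then have "negligible (?J - ?S)"
    by (simp add: negligible_iff_null_sets countable_imp_null_set_lborel null_sets_completionI)
  ultimately have negl: "negligible (?J - ?S \<union> (?S - ?J))"
    by (simp add: Diff_eq_empty_iff[THEN iffD2])
  have "measure lebesgue ?S = measure lebesgue ?J"
    using measure_negligible_symdiff[OF J_meas negl] .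
  then have "measure (lebesgue_on {0..1}) ?S = measure lebesgue ?J"
    by (subst measure_restrict_space) auto
  then show ?thesis
    by (simp add: J_measure q_def q'_def)
qed

theorem proposition2p5:
  fixes N n :: nat and i :: "nat \<Rightarrow> int" and x :: real
  assumes "N \<ge> 1" and "n \<ge> 1"
    and "\<forall>k\<in>{1..n}. i k \<ge> int N"
    and "x \<in> {0..1}"
  shows "cond_prob (lebesgue_on {0..1})
           (\<lambda>\<omega>. (gauss_map N ^^ n) \<omega> < x)
           (\<lambda>\<omega>. \<omega> \<notin> \<rat> \<and> (\<forall>k\<in>{1..n}. digit N k \<omega> = i k))
         = (s_val N i n + real N) * x / (s_val N i n * x + real N)"
proof -
  define q q' where "q = real_of_int (denom_q N i n)" and "q' = real_of_int (denom_q N i (n - 1))"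
  have "\<forall>k\<in>{1..n}. i k \<ge> 1"
    using assms(1,3) by force
  then have q: "q > 0" "q' > 0"
    by (auto simp: q_def q'_def intro!: denom_q_pos)
  \<comment> \<open>As \<open>n\<close> is positive, the bound \<open>x = 1\<close> imposes no
    restriction, so the cylinder itself is the case \<open>x = 1\<close> of the numerator.\<close>
  have less1: "(gauss_map N ^^ n) \<omega> < 1" for \<omega>
    using assms(2) gauss_map_bounds by (cases n) auto
  have num: "measure (lebesgue_on {0..1}) {\<omega>\<in>{0..1}. (gauss_map N ^^ n) \<omega> < x \<and>
      \<omega> \<notin> \<rat> \<and> (\<forall>k\<in>{1..n}. digit N k \<omega> = i k)} = real N ^ n * x / (q * (q + q' * x))"
    using measure_cylinder_gauss_map_less[OF assms] by (simp add: q_def q'_def)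
  have den: "measure (lebesgue_on {0..1}) {\<omega>\<in>{0..1}.
      \<omega> \<notin> \<rat> \<and> (\<forall>k\<in>{1..n}. digit N k \<omega> = i k)} = real N ^ n / (q * (q + q'))"
    using measure_cylinder_gauss_map_less[OF assms(1-3), of 1] less1 by (simp add: q_def q'_def)
  have s: "s_val N i n = real N * q' / q"
    using assms(2) by (simp add: s_val_def q_def q'_def)
  have pos: "q + q' * x > 0" "q + q' > 0" "real N > 0"
    using q assms by (auto intro: add_pos_nonneg)
  \<comment> \<open>The common factor \<open>N / q\<close> is pulled out of both sides of the
    fraction; the last equality then reinstates \<open>N ^ n / q\<close>, which is positive, so the
    conditioning event has positive measure.\<close>
  have "(real N * q' / q + real N) * x / (real N * q' / q * x + real N)
      = (real N * (q + q') / q * x) / (real N * (q + q' * x) / q)"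
    using q by (simp add: field_simps)
  also have "\<dots> = (q + q') * x / (q + q' * x)"
    using q pos by simp
  also have "\<dots> = (real N ^ n * x / (q * (q + q' * x))) / (real N ^ n / (q * (q + q')))"
    using q pos by simp
  finally show ?thesis
    unfolding cond_prob_def s using num den by simp
qed

end
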